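(* Let $X$ be a finite topological $T_0$-space. If $X$ does not have down beat points and $\varphi:\mathbb{R}_0^+\times X\rightarrow X$ is a semiflow, then $\varphi$ is trivial.
   Context: For a finite topological $T_0$-space $X$ and $x\in X$, $U_x$ is the intersection of all open sets containing $x$. The relation $x\leq y \iff U_x\subseteq U_y$ is a partial order on $X$, so $U_x=\{y: y\le x\}$; open sets are exactly the lower sets. A point $x\in X$ is a down beat point if $U_x\setminus\{x\}$ has a maximum. $\mathbb{R}_0^+$ is the set of non-negative real numbers with the usual topology. A semiflow on $X$ is a continuous map $\varphi:\mathbb{R}_0^+\times X\to X$ (product topology on the domain) such that $\varphi(0,x)=x$ for all $x\in X$ and $\varphi(s,\varphi(t,x))=\varphi(s+t,x)$ for all $x\in X$, $s,t\in\mathbb{R}_0^+$. It is trivial if $\varphi(t,\cdot)$ is the identity map of $X$ for every $t\in\mathbb{R}_0^+$. *)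

theory Defs
  imports "HOL-Analysis.Analysis"
begin

definition min_open :: "'a topology \<Rightarrow> 'a \<Rightarrow> 'a set" where
  "min_open X x = \<Inter> {U. openin X U \<and> x \<in> U}"

(* Only meaningful for points of topspace X: outside it, min_open X x is the
   intersection of an empty family. *)
definition spec_le :: "'a topology \<Rightarrow> 'a \<Rightarrow> 'a \<Rightarrow> bool" where
  "spec_le X x y \<longleftrightarrow> min_open X x \<subseteq> min_open X y"

definition down_beat_point :: "'a topology \<Rightarrow> 'a \<Rightarrow> bool" where
  "down_beat_point X x \<longleftrightarrow> x \<in> topspace X \<and>
     (\<exists>m \<in> min_open X x - {x}. \<forall>y \<in> min_open X x - {x}. spec_le X y m)"

(* The non-negative reals are the subspace {0..} of the real line; the values of
   phi outside {0..} \<times> topspace X are irrelevant. *)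
definition semiflow :: "'a topology \<Rightarrow> (real \<times> 'a \<Rightarrow> 'a) \<Rightarrow> bool" where
  "semiflow X \<phi> \<longleftrightarrow>
     continuous_map (prod_topology (top_of_set {0..}) X) X \<phi> \<and>
     (\<forall>x \<in> topspace X. \<phi> (0, x) = x) \<and>
     (\<forall>x \<in> topspace X. \<forall>s \<ge> 0. \<forall>t \<ge> 0. \<phi> (s, \<phi> (t, x)) = \<phi> (s + t, x))"

definition trivial_semiflow :: "'a topology \<Rightarrow> (real \<times> 'a \<Rightarrow> 'a) \<Rightarrow> bool" where
  "trivial_semiflow X \<phi> \<longleftrightarrow> (\<forall>t \<ge> 0. \<forall>x \<in> topspace X. \<phi> (t, x) = x)"

end

theory Submission
  imports Defs
begin

text \<open>By continuity at time \<open>0\<close> and finiteness of \<open>X\<close>, there is \<open>e > 0\<close> such that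
  \<open>\<phi> (t, x) \<le> x\<close> for all \<open>x\<close> and all \<open>t < e\<close>. Fix such a \<open>t\<close>; the map \<open>\<phi> (t, _)\<close> preserves the
  order. If it fixes every \<open>y < x\<close> but moves \<open>x\<close>, then \<open>y = \<phi> (t, y) \<le> \<phi> (t, x) < x\<close> for all
  \<open>y < x\<close>, so \<open>\<phi> (t, x)\<close> is the maximum of \<open>U\<^sub>x - {x}\<close> and \<open>x\<close> is a down beat point. By induction
  on \<open>x\<close>, \<open>\<phi> (t, _)\<close> is the identity for \<open>t < e\<close>, and by the semigroup law for every \<open>t\<close>.\<close>

lemma mem_min_open: "x \<in> min_open X x"
  by (auto simp: min_open_def)

lemma min_open_subset: "openin X U \<Longrightarrow> x \<in> U \<Longrightarrow> min_open X x \<subseteq> U"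
  by (auto simp: min_open_def)

lemma min_open_subset_topspace: "x \<in> topspace X \<Longrightarrow> min_open X x \<subseteq> topspace X"
  by (simp add: min_open_subset)

lemma openin_min_open:
  assumes "finite (topspace X)" "x \<in> topspace X"
  shows "openin X (min_open X x)"
  unfolding min_open_def
proof (rule openin_Inter)
  have "{U. openin X U \<and> x \<in> U} \<subseteq> Pow (topspace X)"
    using openin_subset by auto
  then show "finite {U. openin X U \<and> x \<in> U}"
    by (rule finite_subset) (simp add: assms(1))
qed (use assms(2) in auto)

lemma min_open_mono:
  assumes "finite (topspace X)" "x \<in> topspace X" "y \<in> min_open X x"
  shows "min_open X y \<subseteq> min_open X x"
  using assms by (simp add: min_open_subset openin_min_open)

text \<open>An open set containing exactly one of the two points contains the minimal open set of
  that point but not the other point, so the two minimal open sets differ. This is the antisymmetry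
  of the order.\<close>

lemma min_open_psubset:
  assumes "finite (topspace X)" "t0_space X" "x \<in> topspace X" "y \<in> min_open X x" "y \<noteq> x"
  shows "min_open X y \<subset> min_open X x"
proof -
  have y: "y \<in> topspace X"
    using assms(4) min_open_subset_topspace[OF assms(3)] by blast
  then obtain U where U: "openin X U" "x \<notin> U \<longleftrightarrow> y \<in> U"
    using assms unfolding t0_space_def by metis
  have "min_open X y \<noteq> min_open X x"
    using U min_open_subset[of X U x] min_open_subset[of X U y] mem_min_open[of x X]
      mem_min_open[of y X] by blast
  then show ?thesis
    using min_open_mono[OF assms(1,3,4)] by blast
qed

text \<open>The preimage of \<open>min_open Y (f x)\<close> is an open neighbourhood of
  \<open>x\<close>, hence contains \<open>min_open X x\<close>: continuous maps are
  monotone.\<close>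

lemma continuous_map_min_open:
  assumes "continuous_map X Y f" "finite (topspace Y)" "x \<in> topspace X" "y \<in> min_open X x"
  shows "f y \<in> min_open Y (f x)"
proof -
  have "f x \<in> topspace Y"
    using assms(1,3) continuous_map_image_subset_topspace by blast
  then have "openin X {z \<in> topspace X. f z \<in> min_open Y (f x)}"
    using openin_continuous_map_preimage[OF assms(1)] openin_min_open[OF assms(2)] by blast
  then show ?thesis
    using min_open_subset[of X "{z \<in> topspace X. f z \<in> min_open Y (f x)}" x]
      assms(3,4) mem_min_open[of "f x" Y] by blast
qed

lemma decreasing_continuous_map_eq_id:
  assumes fin: "finite (topspace X)" and t0: "t0_space X"
    and no_beat: "\<not> (\<exists>x \<in> topspace X. down_beat_point X x)"
    and cont: "continuous_map X X f"
    and decr: "\<And>x. x \<in> topspace X \<Longrightarrow> f x \<in> min_open X x"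
    and "x \<in> topspace X"
  shows "f x = x"
  using \<open>x \<in> topspace X\<close>
\<comment> \<open>Points strictly below \<open>x\<close> have strictly smaller minimal open sets, so
  cardinality is a measure for induction along the order.\<close>
proof (induction "card (min_open X x)" arbitrary: x rule: less_induct)
  case less
  have fin_min: "finite (min_open X x)"
    using finite_subset[OF min_open_subset_topspace[OF less.prems] fin] .
  have below: "f y = y" if "y \<in> min_open X x - {x}" for y
  proof (rule less.hyps)
    show "card (min_open X y) < card (min_open X x)"
      using that by (intro psubset_card_mono fin_min min_open_psubset[OF fin t0 less.prems]) auto
    show "y \<in> topspace X"
      using that min_open_subset_topspace[OF less.prems] by blast
  qed
  show ?case
  proof (rule ccontr)
    assume moved: "f x \<noteq> x"
    have fx: "f x \<in> topspace X"
      using decr[OF less.prems] min_open_subset_topspace[OF less.prems] by blast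
    have "spec_le X y (f x)" if "y \<in> min_open X x - {x}" for y
      using continuous_map_min_open[OF cont fin less.prems, of y] below[OF that] that
        min_open_mono[OF fin fx] by (simp add: spec_le_def)
    then have "down_beat_point X x"
      unfolding down_beat_point_def using less.prems decr moved by blast
    then show False
      using no_beat less.prems by blast
  qed
qed

text \<open>Each orbit map is continuous in time and starts at \<open>x\<close>, so it stays in the
  open set \<open>min_open X x\<close> for a short time. Finitely many points allow one common
  bound.\<close>

lemma semiflow_decreasing_near_0:
  assumes fin: "finite (topspace X)" and flow: "semiflow X \<phi>"
  obtains e where "e > 0"
    "\<And>t x. 0 \<le> t \<Longrightarrow> t < e \<Longrightarrow> x \<in> topspace X \<Longrightarrow> \<phi> (t, x) \<in> min_open X x"
proof -
  have "\<exists>e>0. \<forall>t. 0 \<le> t \<longrightarrow> t < e \<longrightarrow> \<phi> (t, x) \<in> min_open X x"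
    if x: "x \<in> topspace X" for x
  proof -
    have "continuous_map (top_of_set {0..}) (prod_topology (top_of_set {0..}) X) (\<lambda>t. (t, x))"
      using x by (simp add: continuous_map_pairedI)
    then have "continuous_map (top_of_set {0..}) X (\<phi> \<circ> (\<lambda>t. (t, x)))"
      using flow continuous_map_compose unfolding semiflow_def by blast
    then have "openin (top_of_set {0..}) {t \<in> {0..}. \<phi> (t, x) \<in> min_open X x}"
      using openin_continuous_map_preimage[OF _ openin_min_open[OF fin x]] by force
    moreover have "0 \<in> {t \<in> {0..}. \<phi> (t, x) \<in> min_open X x}"
      using flow x by (simp add: semiflow_def mem_min_open)
    ultimately obtain e where "e > 0"
      "ball 0 e \<inter> {0..} \<subseteq> {t \<in> {0..}. \<phi> (t, x) \<in> min_open X x}"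
      unfolding openin_contains_ball by blast
    then show ?thesis
      by (intro exI[of _ e]) (auto simp: subset_iff)
  qed
  then obtain e where e: "\<And>x. x \<in> topspace X \<Longrightarrow> e x > (0::real)"
    "\<And>x t. x \<in> topspace X \<Longrightarrow> 0 \<le> t \<Longrightarrow> t < e x \<Longrightarrow> \<phi> (t, x) \<in> min_open X x"
    by metis
  show thesis
  \<comment> \<open>The extra element \<open>1\<close> keeps the set nonempty when \<open>X\<close>
    is the empty space.\<close>
  proof (rule that[of "Min (insert 1 (e ` topspace X))"])
    show "Min (insert 1 (e ` topspace X)) > 0"
      using fin e(1) by simp
  qed (use fin e(2) in simp)
qed

lemma continuous_map_semiflow:
  assumes "semiflow X \<phi>" "t \<ge> 0"
  shows "continuous_map X X (\<lambda>x. \<phi> (t, x))"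
proof -
  have "continuous_map X (prod_topology (top_of_set {0..}) X) (\<lambda>x. (t, x))"
    using assms(2) by (simp add: continuous_map_pairedI)
  then have "continuous_map X X (\<phi> \<circ> (\<lambda>x. (t, x)))"
    using assms(1) continuous_map_compose unfolding semiflow_def by blast
  then show ?thesis
    by (simp add: comp_def)
qed

text \<open>Any time \<open>t\<close> splits into \<open>n\<close> equal steps shorter than
  \<open>e\<close>, each of which fixes \<open>x\<close>; the semigroup law composes them.\<close>

lemma trivial_semiflow_if_trivial_near_0:
  assumes flow: "semiflow X \<phi>" and "e > 0"
    and small: "\<And>t x. 0 \<le> t \<Longrightarrow> t < e \<Longrightarrow> x \<in> topspace X \<Longrightarrow> \<phi> (t, x) = x"
  shows "trivial_semiflow X \<phi>"
  unfolding trivial_semiflow_def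
proof (intro allI impI ballI)
  fix t :: real and x assume t: "0 \<le> t" and x: "x \<in> topspace X"
  obtain n :: nat where n: "t / e < real n"
    using reals_Archimedean2 by blast
  define s where "s = t / real n"
  \<comment> \<open>Even for \<open>t = 0\<close> the strict bound on \<open>n\<close> forces
    \<open>n\<close> to be nonzero, so \<open>s\<close> is a genuine quotient.\<close>
  have "0 \<le> t / e"
    using t \<open>e > 0\<close> by simp
  then have npos: "real n > 0"
    using n by linarith
  have s: "0 \<le> s" "s < e"
    using n npos t \<open>e > 0\<close> by (simp_all add: s_def field_simps)
  have "\<phi> (real k * s, x) = x" for k
  proof (induction k)
    case 0
    then show ?case
      using small[of 0 x] \<open>e > 0\<close> x by simp
  next
    case (Suc k)
    have "\<phi> (real (Suc k) * s, x) = \<phi> (s + real k * s, x)"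
      by (simp add: algebra_simps)
    also have "\<dots> = \<phi> (s, \<phi> (real k * s, x))"
      using flow x s by (simp add: semiflow_def)
    also have "\<dots> = x"
      using Suc small s x by simp
    finally show ?case .
  qed
  from this[of n] show "\<phi> (t, x) = x"
    using npos by (simp add: s_def)
qed

theorem theorem3p6:
  fixes X :: "'a topology" and \<phi> :: "real \<times> 'a \<Rightarrow> 'a"
  assumes "finite (topspace X)"
    and "t0_space X"
    and "\<not> (\<exists>x \<in> topspace X. down_beat_point X x)"
    and "semiflow X \<phi>"
  shows "trivial_semiflow X \<phi>"
proof -
  obtain e where e: "e > 0"
    "\<And>t x. 0 \<le> t \<Longrightarrow> t < e \<Longrightarrow> x \<in> topspace X \<Longrightarrow> \<phi> (t, x) \<in> min_open X x"
    using semiflow_decreasing_near_0[OF assms(1,4)] by blast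
  show ?thesis
  proof (rule trivial_semiflow_if_trivial_near_0[OF assms(4) e(1)])
    fix t x assume "0 \<le> t" "t < e" "x \<in> topspace X"
    then show "\<phi> (t, x) = x"
      using decreasing_continuous_map_eq_id[OF assms(1-3) continuous_map_semiflow[OF assms(4)]] e(2)
      by blast
  qed
qed

end
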